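(* Let $A$ be a finite-dimensional basic algebra over an algebraically closed field $\Bbbk$ (given by a finite quiver with relations), with a filtration by two-sided ideals $A=I_0\supsetneq I_1\supsetneq\dots\supsetneq I_N=0$ such that $I_iI_j\subset I_{i+j}$ for all $i,j$ (with $I_m=0$ for $m\ge N$) and all subquotients $I_i/I_{i+1}$ are semisimple $A$-bimodules. Assume that $A$ is symmetric with symmetric trace form $(\cdot,\cdot)$ and that $(\cdot,\cdot)$ induces a non-degenerate pairing between $A/I_j$ and $I_{N-j}$ for every $j$. Then the algebra $\mathfrak{C}=\mathfrak{C}(A)$ is symmetric.
   Context: A symmetric trace form on $A$ is a non-degenerate symmetric bilinear form $(\cdot,\cdot):A\times A\to\Bbbk$ with $(ab,c)=(a,bc)$; $A$ is symmetric if such a form exists. The (in general non-unital, infinite-dimensional) algebra $\mathfrak{C}(A)$ consists of $\mathbb{Z}\times\mathbb{Z}$-matrices with finitely many nonzero entries, $\mathfrak{C}(A)=\bigoplus_{r,c\in\mathbb{Z}}\mathfrak{C}_{r,c}$, where the entry in row $r$ and column $c$ lies in $$\mathfrak{C}_{r,c}=\begin{cases} I_{r-c}, & r>c,\\ A/I_{N-(c-r)}, & 0\le c-r<N,\\ 0, & c-r\ge N,\end{cases}$$ (where $I_m=0$ for $m\ge N$), with matrix multiplication induced by the multiplication of $A$ (this is well defined because $I_iI_j\subset I_{i+j}$). The algebra $\mathfrak{C}$ is called symmetric if there is a non-degenerate symmetric bilinear form $(\cdot,\cdot)_{\mathfrak C}$ on $\mathfrak{C}$ which is associative, i.e. $(ab,c)_{\mathfrak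 C}=(a,bc)_{\mathfrak C}$ for all $a,b,c\in\mathfrak{C}$. *)

theory Defs
  imports
    "HOL-Computational_Algebra.Polynomial"
    "HOL-Library.Set_Algebras"
    "Graph_Theory.Arc_Walk"
begin

section \<open>Not necessarily unital algebras with explicit carrier\<close>

record ('k, 'a) kalgebra =
  acarrier :: "'a set"
  aadd :: "'a \<Rightarrow> 'a \<Rightarrow> 'a"
  azero :: 'a
  ascale :: "'k \<Rightarrow> 'a \<Rightarrow> 'a"
  amult :: "'a \<Rightarrow> 'a \<Rightarrow> 'a"

locale k_algebra =
  fixes C :: "('k::field, 'a) kalgebra"
  assumes add_closed: "x \<in> acarrier C \<Longrightarrow> y \<in> acarrier C \<Longrightarrow> aadd C x y \<in> acarrier C"
    and zero_closed: "azero C \<in> acarrier C"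
    and scale_closed: "x \<in> acarrier C \<Longrightarrow> ascale C a x \<in> acarrier C"
    and mult_closed: "x \<in> acarrier C \<Longrightarrow> y \<in> acarrier C \<Longrightarrow> amult C x y \<in> acarrier C"
    and add_assoc: "x \<in> acarrier C \<Longrightarrow> y \<in> acarrier C \<Longrightarrow> z \<in> acarrier C \<Longrightarrow>
      aadd C (aadd C x y) z = aadd C x (aadd C y z)"
    and add_commute: "x \<in> acarrier C \<Longrightarrow> y \<in> acarrier C \<Longrightarrow> aadd C x y = aadd C y x"
    and add_zero: "x \<in> acarrier C \<Longrightarrow> aadd C (azero C) x = x"
    and add_inverse: "x \<in> acarrier C \<Longrightarrow> \<exists>y\<in>acarrier C. aadd C x y = azero C"
    and scale_add_right: "x \<in> acarrier C \<Longrightarrow> y \<in> acarrier C \<Longrightarrow>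
      ascale C a (aadd C x y) = aadd C (ascale C a x) (ascale C a y)"
    and scale_add_left: "x \<in> acarrier C \<Longrightarrow>
      ascale C (a + b) x = aadd C (ascale C a x) (ascale C b x)"
    and scale_scale: "x \<in> acarrier C \<Longrightarrow> ascale C a (ascale C b x) = ascale C (a * b) x"
    and scale_one: "x \<in> acarrier C \<Longrightarrow> ascale C 1 x = x"
    and mult_assoc: "x \<in> acarrier C \<Longrightarrow> y \<in> acarrier C \<Longrightarrow> z \<in> acarrier C \<Longrightarrow>
      amult C (amult C x y) z = amult C x (amult C y z)"
    and mult_add_left: "x \<in> acarrier C \<Longrightarrow> y \<in> acarrier C \<Longrightarrow> z \<in> acarrier C \<Longrightarrow>
      amult C (aadd C x y) z = aadd C (amult C x z) (amult C y z)"
    and mult_add_right: "x \<in> acarrier C \<Longrightarrow> y \<in> acarrier C \<Longrightarrow> z \<in> acarrier C \<Longrightarrow>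
      amult C x (aadd C y z) = aadd C (amult C x y) (amult C x z)"
    and mult_scale_left: "x \<in> acarrier C \<Longrightarrow> y \<in> acarrier C \<Longrightarrow>
      amult C (ascale C a x) y = ascale C a (amult C x y)"
    and mult_scale_right: "x \<in> acarrier C \<Longrightarrow> y \<in> acarrier C \<Longrightarrow>
      amult C x (ascale C a y) = ascale C a (amult C x y)"

definition two_sided_ideal :: "('k, 'a) kalgebra \<Rightarrow> 'a set \<Rightarrow> bool" where
  "two_sided_ideal C J \<longleftrightarrow>
     J \<subseteq> acarrier C \<and> azero C \<in> J \<and>
     (\<forall>x\<in>J. \<forall>y\<in>J. aadd C x y \<in> J) \<and>
     (\<forall>a. \<forall>x\<in>J. ascale C a x \<in> J) \<and>
     (\<forall>a\<in>acarrier C. \<forall>x\<in>J. amult C a x \<in> J \<and> amult C x a \<in> J)"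

definition generated_ideal :: "('k, 'a) kalgebra \<Rightarrow> 'a set \<Rightarrow> 'a set" where
  "generated_ideal C R = \<Inter>{J. two_sided_ideal C J \<and> R \<subseteq> J}"

definition algebra_hom :: "('k, 'a) kalgebra \<Rightarrow> ('k, 'b) kalgebra \<Rightarrow> ('a \<Rightarrow> 'b) \<Rightarrow> bool" where
  "algebra_hom C D \<phi> \<longleftrightarrow>
     (\<forall>x\<in>acarrier C. \<phi> x \<in> acarrier D) \<and>
     (\<forall>x\<in>acarrier C. \<forall>y\<in>acarrier C. \<phi> (aadd C x y) = aadd D (\<phi> x) (\<phi> y)) \<and>
     (\<forall>a. \<forall>x\<in>acarrier C. \<phi> (ascale C a x) = ascale D a (\<phi> x)) \<and>
     (\<forall>x\<in>acarrier C. \<forall>y\<in>acarrier C. \<phi> (amult C x y) = amult D (\<phi> x) (\<phi> y))"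


section \<open>Symmetric algebras\<close>

definition nondegenerate_pairing ::
  "'v set \<Rightarrow> 'v \<Rightarrow> 'w set \<Rightarrow> 'w \<Rightarrow> ('v \<Rightarrow> 'w \<Rightarrow> 'k::zero) \<Rightarrow> bool" where
  "nondegenerate_pairing V zero_V W zero_W P \<longleftrightarrow>
     (\<forall>v\<in>V. (\<forall>w\<in>W. P v w = 0) \<longrightarrow> v = zero_V) \<and>
     (\<forall>w\<in>W. (\<forall>v\<in>V. P v w = 0) \<longrightarrow> w = zero_W)"

definition bilinear_form :: "('k::field, 'a) kalgebra \<Rightarrow> ('a \<Rightarrow> 'a \<Rightarrow> 'k) \<Rightarrow> bool" where
  "bilinear_form C \<beta> \<longleftrightarrow>
     (\<forall>x\<in>acarrier C. \<forall>y\<in>acarrier C. \<forall>z\<in>acarrier C.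
        \<beta> (aadd C x y) z = \<beta> x z + \<beta> y z \<and> \<beta> x (aadd C y z) = \<beta> x y + \<beta> x z) \<and>
     (\<forall>a. \<forall>x\<in>acarrier C. \<forall>y\<in>acarrier C.
        \<beta> (ascale C a x) y = a * \<beta> x y \<and> \<beta> x (ascale C a y) = a * \<beta> x y)"

definition symmetric_trace_form :: "('k::field, 'a) kalgebra \<Rightarrow> ('a \<Rightarrow> 'a \<Rightarrow> 'k) \<Rightarrow> bool" where
  "symmetric_trace_form C \<beta> \<longleftrightarrow>
     bilinear_form C \<beta> \<and>
     (\<forall>x\<in>acarrier C. \<forall>y\<in>acarrier C. \<beta> x y = \<beta> y x) \<and>
     nondegenerate_pairing (acarrier C) (azero C) (acarrier C) (azero C) \<beta> \<and>
     (\<forall>x\<in>acarrier C. \<forall>y\<in>acarrier C. \<forall>z\<in>acarrier C.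
        \<beta> (amult C x y) z = \<beta> x (amult C y z))"

definition symmetric_algebra :: "('k::field, 'a) kalgebra \<Rightarrow> bool" where
  "symmetric_algebra C \<longleftrightarrow> k_algebra C \<and> (\<exists>\<beta>. symmetric_trace_form C \<beta>)"


section \<open>Finite-dimensional basic algebras\<close>

locale finite_dim_algebra = vector_space scale
  for scale :: "'k::field \<Rightarrow> 'a::ring_1 \<Rightarrow> 'a" +
  assumes scale_mult_left: "scale c x * y = scale c (x * y)"
    and scale_mult_right: "x * scale c y = scale c (x * y)"
    and finite_dim: "\<exists>B. finite B \<and> span B = UNIV"

definition type_algebra :: "('k \<Rightarrow> 'a \<Rightarrow> 'a) \<Rightarrow> ('k, 'a::ring_1) kalgebra" where
  "type_algebra scale =
     \<lparr>acarrier = UNIV, aadd = (+), azero = 0, ascale = scale, amult = (*)\<rparr>"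

definition primitive_idempotent :: "'a::ring_1 \<Rightarrow> bool" where
  "primitive_idempotent e \<longleftrightarrow> e \<noteq> 0 \<and> e * e = e \<and>
     \<not> (\<exists>f g. f \<noteq> 0 \<and> g \<noteq> 0 \<and> f * f = f \<and> g * g = g \<and> f * g = 0 \<and> g * f = 0 \<and> e = f + g)"

definition right_modules_isomorphic :: "'a::ring_1 set \<Rightarrow> 'a set \<Rightarrow> bool" where
  "right_modules_isomorphic P P' \<longleftrightarrow>
     (\<exists>h. bij_betw h P P' \<and> (\<forall>x\<in>P. \<forall>y\<in>P. h (x + y) = h x + h y) \<and>
          (\<forall>x\<in>P. \<forall>a. h (x * a) = h x * a))"

text \<open>An algebra is basic if the indecomposable projectives occurring in a decomposition of
  the regular module are pairwise non-isomorphic.\<close>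

definition basic_algebra :: "'a::ring_1 itself \<Rightarrow> bool" where
  "basic_algebra T \<longleftrightarrow>
     (\<exists>E::'a set. finite E \<and> (\<forall>e\<in>E. primitive_idempotent e) \<and>
        (\<forall>e\<in>E. \<forall>f\<in>E. e \<noteq> f \<longrightarrow> e * f = 0) \<and> \<Sum>E = 1 \<and>
        (\<forall>e\<in>E. \<forall>f\<in>E. e \<noteq> f \<longrightarrow> \<not> right_modules_isomorphic (e *o UNIV) (f *o UNIV)))"


section \<open>Quivers with relations\<close>

text \<open>A path is a pair \<open>(u, p)\<close> of its source and its list of arrows; \<open>(u, [])\<close> is the trivial
  path at \<open>u\<close>. Paths are composed in the order in which they are traversed. An element of the
  path algebra is a finitely supported coefficient function on paths.\<close>

definition quiver_paths :: "('v, 'e) pre_digraph \<Rightarrow> ('v \<times> 'e list) set" where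
  "quiver_paths Q = {(u, p). \<exists>v. pre_digraph.awalk Q u p v}"

definition path_algebra ::
  "('v, 'e) pre_digraph \<Rightarrow> ('k::field, 'v \<times> 'e list \<Rightarrow> 'k) kalgebra" where
  "path_algebra Q =
     \<lparr>acarrier = {f. finite {w. f w \<noteq> 0} \<and> {w. f w \<noteq> 0} \<subseteq> quiver_paths Q},
      aadd = (\<lambda>f g w. f w + g w),
      azero = (\<lambda>w. 0),
      ascale = (\<lambda>c f w. c * f w),
      amult = (\<lambda>f g (u, p). \<Sum>i\<le>length p.
        f (u, take i p) * g (last (pre_digraph.awalk_verts Q u (take i p)), drop i p))\<rparr>"

text \<open>The algebra is isomorphic to the quotient of the path algebra by the ideal generated
  by the relations \<open>R\<close>. A surjective homomorphism is automatically unital.\<close>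

definition given_by_quiver ::
  "('k::field, 'a) kalgebra \<Rightarrow> ('v, 'e) pre_digraph \<Rightarrow> ('v \<times> 'e list \<Rightarrow> 'k) set \<Rightarrow> bool" where
  "given_by_quiver C Q R \<longleftrightarrow>
     R \<subseteq> acarrier (path_algebra Q) \<and>
     (\<exists>\<phi>. algebra_hom (path_algebra Q) C \<phi> \<and>
          \<phi> ` acarrier (path_algebra Q) = acarrier C \<and>
          {f \<in> acarrier (path_algebra Q). \<phi> f = azero C} = generated_ideal (path_algebra Q) R)"


section \<open>Quotients and semisimple bimodules\<close>

text \<open>The elements of \<open>V/W\<close> are the cosets of \<open>W\<close>, as sets; sums and products of sets are
  elementwise, from \<^theory>\<open>HOL-Library.Set_Algebras\<close>.\<close>

definition quotient_space :: "'a::plus set \<Rightarrow> 'a set \<Rightarrow> 'a set set" where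
  "quotient_space V W = (\<lambda>x. x +o W) ` V"

record ('a, 'm) bimodule =
  bcarrier :: "'m set"
  badd :: "'m \<Rightarrow> 'm \<Rightarrow> 'm"
  bzero :: 'm
  bleft :: "'a \<Rightarrow> 'm \<Rightarrow> 'm"
  bright :: "'m \<Rightarrow> 'a \<Rightarrow> 'm"

definition quotient_bimodule :: "'a::ring_1 set \<Rightarrow> 'a set \<Rightarrow> ('a, 'a set) bimodule" where
  "quotient_bimodule V W =
     \<lparr>bcarrier = quotient_space V W, badd = (+), bzero = W,
      bleft = (\<lambda>a X. {a} * X + W), bright = (\<lambda>X a. X * {a} + W)\<rparr>"

text \<open>Closure under negation and under scalars is implied, since the acting algebra is unital.\<close>

definition subbimodule :: "('a, 'm) bimodule \<Rightarrow> 'm set \<Rightarrow> bool" where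
  "subbimodule M S \<longleftrightarrow>
     S \<subseteq> bcarrier M \<and> bzero M \<in> S \<and> (\<forall>x\<in>S. \<forall>y\<in>S. badd M x y \<in> S) \<and>
     (\<forall>a. \<forall>x\<in>S. bleft M a x \<in> S \<and> bright M x a \<in> S)"

definition generated_subbimodule :: "('a, 'm) bimodule \<Rightarrow> 'm set \<Rightarrow> 'm set" where
  "generated_subbimodule M X = \<Inter>{S. subbimodule M S \<and> X \<subseteq> S}"

definition simple_subbimodule :: "('a, 'm) bimodule \<Rightarrow> 'm set \<Rightarrow> bool" where
  "simple_subbimodule M S \<longleftrightarrow>
     subbimodule M S \<and> S \<noteq> {bzero M} \<and>
     (\<forall>T. subbimodule M T \<and> T \<subseteq> S \<longrightarrow> T = {bzero M} \<or> T = S)"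

text \<open>Semisimple means: the internal direct sum of a family of simple sub-bimodules.\<close>

definition semisimple_bimodule :: "('a, 'm) bimodule \<Rightarrow> bool" where
  "semisimple_bimodule M \<longleftrightarrow>
     (\<exists>\<S>. (\<forall>S\<in>\<S>. simple_subbimodule M S) \<and>
          generated_subbimodule M (\<Union>\<S>) = bcarrier M \<and>
          (\<forall>S\<in>\<S>. S \<inter> generated_subbimodule M (\<Union>(\<S> - {S})) = {bzero M}))"


section \<open>Filtrations and the matrix algebra\<close>

definition ideal_filtration ::
  "('k \<Rightarrow> 'a \<Rightarrow> 'a) \<Rightarrow> (nat \<Rightarrow> 'a::ring_1 set) \<Rightarrow> nat \<Rightarrow> bool" where
  "ideal_filtration scale I N \<longleftrightarrow>
     (\<forall>i. two_sided_ideal (type_algebra scale) (I i)) \<and>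
     I 0 = UNIV \<and> (\<forall>i<N. I (Suc i) \<subset> I i) \<and> (\<forall>m\<ge>N. I m = {0}) \<and>
     (\<forall>i j. I i * I j \<subseteq> I (i + j))"

text \<open>The existence of the induced map \<open>P\<close> expresses that the pairing of a coset in \<open>A/J\<close> with an
  element of \<open>K\<close> does not depend on the chosen representative.\<close>

definition induces_nondegenerate_pairing ::
  "('a::ring_1 \<Rightarrow> 'a \<Rightarrow> 'k::field) \<Rightarrow> 'a set \<Rightarrow> 'a set \<Rightarrow> bool" where
  "induces_nondegenerate_pairing \<beta> J K \<longleftrightarrow>
     (\<exists>P. (\<forall>a. \<forall>y\<in>K. P (a +o J) y = \<beta> a y) \<and>
          nondegenerate_pairing (quotient_space UNIV J) J K 0 P)"

text \<open>Each entry space is a quotient \<open>V/W\<close>, where \<open>W\<close> is given by \<open>entry_den\<close>: below the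
  diagonal \<open>I\<^sub>r\<^sub>-\<^sub>c\<close> is represented as \<open>I\<^sub>r\<^sub>-\<^sub>c/0\<close>, and the zero spaces far above the diagonal as
  \<open>A/A\<close>.\<close>

definition entry_den :: "(nat \<Rightarrow> 'a::ring_1 set) \<Rightarrow> nat \<Rightarrow> int \<Rightarrow> int \<Rightarrow> 'a set" where
  "entry_den I N r c =
     (if r > c then {0} else if c - r < int N then I (N - nat (c - r)) else UNIV)"

definition entry_space :: "(nat \<Rightarrow> 'a::ring_1 set) \<Rightarrow> nat \<Rightarrow> int \<Rightarrow> int \<Rightarrow> 'a set set" where
  "entry_space I N r c =
     quotient_space (if r > c then I (nat (r - c)) else UNIV) (entry_den I N r c)"

text \<open>In a product, \<open>X r s * Y s c\<close> is contained in a single coset of \<open>entry_den I N r c\<close>, and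
  adding \<open>entry_den I N r c\<close> completes the sum of these sets to a full coset.\<close>

definition matrix_algebra ::
  "('k \<Rightarrow> 'a \<Rightarrow> 'a) \<Rightarrow> (nat \<Rightarrow> 'a::ring_1 set) \<Rightarrow> nat \<Rightarrow> ('k, int \<Rightarrow> int \<Rightarrow> 'a set) kalgebra" where
  "matrix_algebra scale I N =
     \<lparr>acarrier = {X. (\<forall>r c. X r c \<in> entry_space I N r c) \<and>
                     finite {(r, c). X r c \<noteq> entry_den I N r c}},
      aadd = (\<lambda>X Y r c. X r c + Y r c),
      azero = entry_den I N,
      ascale = (\<lambda>a X r c. scale a ` X r c + entry_den I N r c),
      amult = (\<lambda>X Y r c.
        (\<Sum>s | X r s \<noteq> entry_den I N r s \<and> Y s c \<noteq> entry_den I N s c. X r s * Y s c)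
        + entry_den I N r c)\<rparr>"

end

theory Submission
  imports Defs
begin

text \<open>
  The form on \<open>\<CC>(A)\<close> comes from the matrix trace: with entries represented in \<open>A\<close>,
  \<open>(X, Y) = \<Sum>r c. (X\<^sub>r\<^sub>c, Y\<^sub>c\<^sub>r)\<close>, the form evaluated at the trace of \<open>X Y\<close> and \<open>1\<close>. What
  makes the proof short is a uniform description of the entry spaces. Writing \<open>I\<^sub>m = A\<close> for
  \<open>m < 0\<close> (and \<open>I\<^sub>m = 0\<close> for \<open>m \<ge> N\<close>), the entry space at \<open>(r, c)\<close> is
  \<open>I\<^sub>r\<^sub>-\<^sub>c / I\<^sub>N\<^sub>+\<^sub>r\<^sub>-\<^sub>c\<close> at every position, so \<open>\<CC>(A)\<close> is the quotient \<open>M/K\<close> of the algebra \<open>M\<close>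
  of finitely supported matrices with \<open>x\<^sub>r\<^sub>c \<in> I\<^sub>r\<^sub>-\<^sub>c\<close> by the ideal \<open>K\<close> of those with
  \<open>x\<^sub>r\<^sub>c \<in> I\<^sub>N\<^sub>+\<^sub>r\<^sub>-\<^sub>c\<close> (lemmas \<open>entry_den_eq\<close> and \<open>matrix_algebra_quotient\<close>).

  On \<open>M\<close> the trace \<open>\<Sum>r c. (x\<^sub>r\<^sub>c, y\<^sub>c\<^sub>r)\<close> is bilinear, symmetric and associative because the form on
  \<open>A\<close> is. It descends to a non-degenerate form on \<open>M/K\<close> exactly if its radical is \<open>K\<close>
  (lemma \<open>symmetric_algebra_of_radical\<close>), and since matrices with a single nonzero entry lie in
  \<open>M\<close>, the radical can be computed entry by entry: the claim is that \<open>I\<^sub>N\<^sub>+\<^sub>k\<close> is the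
  annihilator of \<open>I\<^sub>-\<^sub>k\<close> inside \<open>I\<^sub>k\<close>, for every integer \<open>k = r - c\<close>. One inclusion
  (lemma \<open>D_annihilates\<close>) is \<open>(d, v) = (d v, 1)\<close> with \<open>d v \<in> I\<^sub>N = 0\<close>. The other (lemma
  \<open>annihilator_le_D\<close>) is the assumed non-degeneracy when \<open>\<bar>k\<bar> \<le> N\<close>: for \<open>k \<le> 0\<close> that of the
  pairing between \<open>A/I\<^sub>N\<^sub>+\<^sub>k\<close> and \<open>I\<^sub>-\<^sub>k\<close> on the side of \<open>A/I\<^sub>N\<^sub>+\<^sub>k\<close>, and for \<open>k > 0\<close> that of
  the pairing between \<open>A/I\<^sub>N\<^sub>-\<^sub>k\<close> and \<open>I\<^sub>k\<close> on the side of \<open>I\<^sub>k\<close>. Beyond that range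
  \<open>I\<^sub>N\<^sub>+\<^sub>k = I\<^sub>k\<close>.
\<close>

section \<open>Symmetric forms on quotient algebras\<close>

context k_algebra
begin

lemma scale_zero:
  assumes "x \<in> acarrier C"
  shows "ascale C 0 x = azero C"
proof -
  let ?o = "ascale C 0 x"
  have o: "?o \<in> acarrier C" using assms by (rule scale_closed)
  then obtain y where y: "y \<in> acarrier C" "aadd C ?o y = azero C" using add_inverse by blast
  have "aadd C ?o ?o = ?o" using scale_add_left[OF assms, of 0 0] by simp
  then have "aadd C ?o (aadd C ?o y) = aadd C ?o y" using add_assoc[OF o o y(1)] by simp
  then show ?thesis using y o add_zero add_commute zero_closed by metis
qed

lemma add_scale_minus_one:
  assumes "x \<in> acarrier C"
  shows "aadd C x (ascale C (- 1) x) = azero C"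
  using scale_add_left[OF assms, of 1 "- 1"] scale_zero[OF assms] scale_one[OF assms] by simp

end

lemma k_algebra_hom_image:
  assumes M: "k_algebra M" and hom: "algebra_hom M C q"
    and surj: "q ` acarrier M = acarrier C" and zero: "q (azero M) = azero C"
  shows "k_algebra C"
proof -
  interpret k_algebra M by (rule M)
  have h: "aadd C (q x) (q y) = q (aadd M x y)" "amult C (q x) (q y) = q (amult M x y)"
    if "x \<in> acarrier M" "y \<in> acarrier M" for x y
    using hom that unfolding algebra_hom_def by auto
  have h': "ascale C a (q x) = q (ascale M a x)" if "x \<in> acarrier M" for x a
    using hom that unfolding algebra_hom_def by auto
  note closed = add_closed zero_closed scale_closed mult_closed
  note laws = add_assoc add_zero scale_add_right scale_add_left scale_scale scale_one mult_assoc
    mult_add_left mult_add_right mult_scale_left mult_scale_right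
  have inverse: "\<exists>y\<in>q ` acarrier M. aadd C (q x) y = q (azero M)" if x: "x \<in> acarrier M" for x
  proof -
    obtain y where "y \<in> acarrier M" "aadd M x y = azero M" using add_inverse[OF x] by blast
    then show ?thesis using h(1)[OF x] by (intro bexI[of _ "q y"]) auto
  qed
  have commute: "q (aadd M x y) = q (aadd M y x)" if "x \<in> acarrier M" "y \<in> acarrier M" for x y
    using add_commute[OF that] by simp
  show ?thesis
    unfolding k_algebra_def surj[symmetric] zero[symmetric]
    by (safe; (rule inverse, assumption)?; simp add: h h' closed laws; (rule commute; assumption)?)
qed

text \<open>A form on \<open>M\<close> induces a form on a quotient of \<open>M\<close> if the kernel lies in its radical, and the
  induced form is non-degenerate if the radical is no larger than the kernel.\<close>

lemma symmetric_algebra_of_radical: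
  assumes M: "k_algebra M" and hom: "algebra_hom M C q"
    and surj: "q ` acarrier M = acarrier C" and zero: "q (azero M) = azero C"
    and bilinear: "bilinear_form M \<tau>"
    and sym: "\<And>x y. x \<in> acarrier M \<Longrightarrow> y \<in> acarrier M \<Longrightarrow> \<tau> x y = \<tau> y x"
    and assoc: "\<And>x y z. x \<in> acarrier M \<Longrightarrow> y \<in> acarrier M \<Longrightarrow> z \<in> acarrier M \<Longrightarrow>
      \<tau> (amult M x y) z = \<tau> x (amult M y z)"
    and radical: "\<And>x. x \<in> acarrier M \<Longrightarrow>
      (\<forall>y\<in>acarrier M. \<tau> x y = 0) \<longleftrightarrow> q x = azero C"
  shows "symmetric_algebra C"
proof -
  interpret M: k_algebra M by (rule M)
  interpret C: k_algebra C using M hom surj zero by (rule k_algebra_hom_image)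
  have h: "aadd C (q x) (q y) = q (aadd M x y)" "amult C (q x) (q y) = q (amult M x y)"
    if "x \<in> acarrier M" "y \<in> acarrier M" for x y
    using hom that unfolding algebra_hom_def by auto
  have h': "ascale C a (q x) = q (ascale M a x)" if "x \<in> acarrier M" for x a
    using hom that unfolding algebra_hom_def by auto
  have t: "\<tau> (aadd M x y) z = \<tau> x z + \<tau> y z" "\<tau> x (aadd M y z) = \<tau> x y + \<tau> x z"
    if "x \<in> acarrier M" "y \<in> acarrier M" "z \<in> acarrier M" for x y z
    using bilinear that unfolding bilinear_form_def by auto
  have t': "\<tau> (ascale M a x) y = a * \<tau> x y" "\<tau> x (ascale M a y) = a * \<tau> x y"
    if "x \<in> acarrier M" "y \<in> acarrier M" for x y a
    using bilinear that unfolding bilinear_form_def by auto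
  note closed = M.add_closed M.zero_closed M.scale_closed M.mult_closed
  have cong: "\<tau> x y = \<tau> x' y"
    if x: "x \<in> acarrier M" "x' \<in> acarrier M" "q x = q x'" and y: "y \<in> acarrier M" for x x' y
  proof -
    let ?d = "aadd M x (ascale M (- 1) x')"
    have "q x' \<in> acarrier C" using x surj by blast
    then have "q ?d = azero C"
      using x C.add_scale_minus_one by (simp add: h[symmetric] h'[symmetric] closed)
    then have "\<tau> ?d y = 0" using radical[of ?d] x y by (simp add: closed)
    then show ?thesis using x y by (simp add: t t' closed)
  qed
  define l where "l = inv_into (acarrier M) q"
  define \<gamma> where "\<gamma> X Y = \<tau> (l X) (l Y)" for X Y
  have l: "l (q x) \<in> acarrier M" "q (l (q x)) = q x" if "x \<in> acarrier M" for x
    unfolding l_def using that by (auto intro: inv_into_into f_inv_into_f)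
  have \<gamma>: "\<gamma> (q x) (q y) = \<tau> x y" if "x \<in> acarrier M" "y \<in> acarrier M" for x y
  proof -
    have "\<tau> (l (q x)) (l (q y)) = \<tau> x (l (q y))" using l that by (intro cong) auto
    also have "\<dots> = \<tau> (l (q y)) x" using sym l that by auto
    also have "\<dots> = \<tau> y x" using l that by (intro cong) auto
    finally show ?thesis unfolding \<gamma>_def using sym that by simp
  qed
  have "symmetric_trace_form C \<gamma>"
    unfolding symmetric_trace_form_def bilinear_form_def nondegenerate_pairing_def
      surj[symmetric] ball_simps
  proof (intro conjI ballI allI impI)
    fix x assume x: "x \<in> acarrier M" "\<forall>y\<in>acarrier M. \<gamma> (q x) (q y) = 0"
    then show "q x = azero C" using \<gamma> radical by simp
  next
    fix x assume x: "x \<in> acarrier M" "\<forall>y\<in>acarrier M. \<gamma> (q y) (q x) = 0"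
    then have "\<forall>y\<in>acarrier M. \<tau> x y = 0" using \<gamma> sym by simp
    then show "q x = azero C" using x radical by simp
  qed (simp_all add: h h' \<gamma> t t' assoc closed, simp add: sym)
  then show ?thesis using C.k_algebra_axioms unfolding symmetric_algebra_def by blast
qed


section \<open>Finitely supported matrices\<close>

definition supported_on :: "'i set \<Rightarrow> ('i \<Rightarrow> 'i \<Rightarrow> 'a::zero) \<Rightarrow> bool" where
  "supported_on F x \<longleftrightarrow> finite F \<and> (\<forall>r c. x r c \<noteq> 0 \<longrightarrow> r \<in> F \<and> c \<in> F)"

definition finitary :: "('i \<Rightarrow> 'i \<Rightarrow> 'a::zero) \<Rightarrow> bool" where
  "finitary x \<longleftrightarrow> (\<exists>F. supported_on F x)"

text \<open>Restricting the summation to the nonzero entries of \<open>x\<close> makes the sum finite when the index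
  type is infinite and \<open>x\<close> is finitary.\<close>

definition matmul :: "('i \<Rightarrow> 'i \<Rightarrow> 'a::semiring_0) \<Rightarrow> ('i \<Rightarrow> 'i \<Rightarrow> 'a) \<Rightarrow> 'i \<Rightarrow> 'i \<Rightarrow> 'a" where
  "matmul x y r c = (\<Sum>s | x r s \<noteq> 0. x r s * y s c)"

lemma supported_on_mono: "supported_on F x \<Longrightarrow> F \<subseteq> G \<Longrightarrow> finite G \<Longrightarrow> supported_on G x"
  unfolding supported_on_def by blast

lemma supported_on_finite: "supported_on F x \<Longrightarrow> finite F"
  by (simp add: supported_on_def)

lemma finitary_common_support:
  assumes "finitary x" "finitary y" "finitary z" "finite G"
  obtains F where "G \<subseteq> F" "supported_on F x" "supported_on F y" "supported_on F z"
proof -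
  obtain A B C where s: "supported_on A x" "supported_on B y" "supported_on C z"
    using assms unfolding finitary_def by blast
  then have "finite (A \<union> B \<union> C \<union> G)" using assms(4) by (auto dest: supported_on_finite)
  then show ?thesis using s by (intro that[of "A \<union> B \<union> C \<union> G"]) (auto elim!: supported_on_mono)
qed

lemma finitary_iff: "finitary x \<longleftrightarrow> finite {(r, c). x r c \<noteq> 0}"
proof
  assume "finitary x"
  then obtain F where F: "supported_on F x" unfolding finitary_def by blast
  then have "{(r, c). x r c \<noteq> 0} \<subseteq> F \<times> F" unfolding supported_on_def by auto
  then show "finite {(r, c). x r c \<noteq> 0}"
    using F by (meson finite_SigmaI finite_subset supported_on_finite)
next
  let ?S = "{(r, c). x r c \<noteq> 0}"
  assume "finite ?S"
  then have "supported_on (fst ` ?S \<union> snd ` ?S) x"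
    unfolding supported_on_def by force
  then show "finitary x" unfolding finitary_def by blast
qed

lemma matmul_eq_sum:
  assumes "supported_on F x"
  shows "matmul x y r c = (\<Sum>s\<in>F. x r s * y s c)"
  unfolding matmul_def
  by (rule sum.mono_neutral_left) (use assms in \<open>auto simp: supported_on_def\<close>)

lemma supported_on_matmul:
  assumes "supported_on F x" "supported_on F y"
  shows "supported_on F (matmul x y)"
proof -
  have "r \<in> F \<and> c \<in> F" if "matmul x y r c \<noteq> 0" for r c
  proof -
    have "\<exists>s\<in>F. x r s * y s c \<noteq> 0"
    proof (rule ccontr)
      assume "\<not> (\<exists>s\<in>F. x r s * y s c \<noteq> 0)"
      then have "matmul x y r c = 0" unfolding matmul_eq_sum[OF assms(1)] by simp
      then show False using that by simp
    qed
    then obtain s where "x r s * y s c \<noteq> 0" by blast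
    then have "x r s \<noteq> 0" "y s c \<noteq> 0" by auto
    then show ?thesis using assms unfolding supported_on_def by blast
  qed
  then show ?thesis using assms unfolding supported_on_def by blast
qed

lemma supported_on_add:
  fixes x y :: "'i \<Rightarrow> 'i \<Rightarrow> 'a::monoid_add"
  assumes "supported_on F x" "supported_on F y"
  shows "supported_on F (\<lambda>r c. x r c + y r c)"
proof -
  have "x r c \<noteq> 0 \<or> y r c \<noteq> 0" if "x r c + y r c \<noteq> 0" for r c
    using that by auto
  then show ?thesis using assms unfolding supported_on_def by blast
qed

lemma finitary_matmul: "finitary x \<Longrightarrow> finitary y \<Longrightarrow> finitary (matmul x y)"
  by (rule finitary_common_support[of x y y "{}"])
    (auto simp: finitary_def intro: supported_on_matmul)

lemma finitary_add:
  fixes x y :: "'i \<Rightarrow> 'i \<Rightarrow> 'a::monoid_add"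
  shows "finitary x \<Longrightarrow> finitary y \<Longrightarrow> finitary (\<lambda>r c. x r c + y r c)"
  by (rule finitary_common_support[of x y y "{}"])
    (auto simp: finitary_def intro: supported_on_add)

lemma finitary_map:
  assumes "finitary x" "f 0 = 0"
  shows "finitary (\<lambda>r c. f (x r c))"
proof -
  obtain F where "supported_on F x" using assms(1) unfolding finitary_def by blast
  moreover have "x r c \<noteq> 0" if "f (x r c) \<noteq> 0" for r c
    using that assms(2) by auto
  ultimately have "supported_on F (\<lambda>r c. f (x r c))"
    unfolding supported_on_def by blast
  then show ?thesis unfolding finitary_def by blast
qed

lemma finitary_zero: "finitary (\<lambda>r c. 0)"
  unfolding finitary_def supported_on_def by auto

lemma finitary_single: "finitary (\<lambda>r c. if r = i \<and> c = j then a else 0)"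
  unfolding finitary_def supported_on_def by (rule exI[of _ "{i, j}"]) auto

lemma matmul_assoc:
  assumes "finitary x" "finitary y" "finitary z"
  shows "matmul (matmul x y) z = matmul x (matmul y z)"
proof (intro ext)
  fix r c
  obtain F where F: "supported_on F x" "supported_on F y" "supported_on F z"
    using assms finitary_common_support[of x y z "{}"] by blast
  note [simp] = matmul_eq_sum[OF F(1)] matmul_eq_sum[OF F(2)]
    matmul_eq_sum[OF supported_on_matmul[OF F(1,2)]]
  show "matmul (matmul x y) z r c = matmul x (matmul y z) r c"
    by (simp add: sum_distrib_left sum_distrib_right mult.assoc) (rule sum.swap)
qed

lemma matmul_add_left:
  assumes "finitary x" "finitary y"
  shows "matmul (\<lambda>r c. x r c + y r c) z = (\<lambda>r c. matmul x z r c + matmul y z r c)"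
proof (intro ext)
  fix r c
  obtain F where F: "supported_on F x" "supported_on F y"
    using assms finitary_common_support[of x y y "{}"] by blast
  show "matmul (\<lambda>r c. x r c + y r c) z r c = matmul x z r c + matmul y z r c"
    by (simp add: matmul_eq_sum[OF F(1)] matmul_eq_sum[OF F(2)]
        matmul_eq_sum[OF supported_on_add[OF F]] distrib_right sum.distrib)
qed

lemma matmul_add_right:
  "matmul x (\<lambda>r c. y r c + z r c) = (\<lambda>r c. matmul x y r c + matmul x z r c)"
  by (simp add: fun_eq_iff matmul_def distrib_left sum.distrib)


section \<open>The matrix algebra as a quotient\<close>

locale filtered_algebra = vector_space scale
  for scale :: "'k::field \<Rightarrow> 'a::ring_1 \<Rightarrow> 'a" +
  fixes I :: "nat \<Rightarrow> 'a set" and N :: nat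
  assumes scale_mult_left: "scale c x * y = scale c (x * y)"
    and scale_mult_right: "x * scale c y = scale c (x * y)"
    and filtration: "ideal_filtration scale I N"
begin

abbreviation D :: "int \<Rightarrow> int \<Rightarrow> 'a set" where
  "D \<equiv> entry_den I N"

lemma ideal: "two_sided_ideal (type_algebra scale) (I i)"
  using filtration unfolding ideal_filtration_def by blast

lemma subspace_I: "subspace (I i)"
  using ideal[of i] unfolding two_sided_ideal_def type_algebra_def subspace_def by simp

lemma I_0: "I 0 = UNIV" and I_ge_N: "m \<ge> N \<Longrightarrow> I m = {0}"
  using filtration unfolding ideal_filtration_def by auto

lemma mult_I: "x \<in> I i \<Longrightarrow> y \<in> I j \<Longrightarrow> x * y \<in> I (i + j)"
  using filtration unfolding ideal_filtration_def by blast

lemma I_antimono: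
  assumes "i \<le> j"
  shows "I j \<subseteq> I i"
proof (rule lift_Suc_antimono_le[OF _ assms])
  fix n
  show "I (Suc n) \<subseteq> I n"
  proof (cases "n < N")
    case True
    then show ?thesis using filtration unfolding ideal_filtration_def by blast
  next
    case False
    then show ?thesis using I_ge_N by simp
  qed
qed

text \<open>Truncation \<open>nat\<close> implements the convention that \<open>I\<^sub>m = A\<close> for negative \<open>m\<close>; the products
  remain compatible because \<open>nat\<close> is subadditive.\<close>

lemma mult_I_nat:
  assumes "x \<in> I (nat i)" "y \<in> I (nat j)" "k \<le> i + j"
  shows "x * y \<in> I (nat k)"
proof -
  have "nat k \<le> nat i + nat j" using assms(3) by linarith
  then show ?thesis using mult_I[OF assms(1,2)] I_antimono by blast
qed

lemma entry_den_eq: "D r c = I (nat (int N + r - c))"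
proof -
  consider "r > c" | "r \<le> c" "c - r < int N" | "r \<le> c" "c - r \<ge> int N" by linarith
  then show ?thesis
  proof cases
    case 1
    then show ?thesis by (simp add: entry_den_def I_ge_N)
  next
    case 2
    then have "N - nat (c - r) = nat (int N + r - c)" by linarith
    then show ?thesis using 2 by (simp add: entry_den_def)
  next
    case 3
    then show ?thesis by (simp add: entry_den_def I_0)
  qed
qed

lemma entry_space_eq: "entry_space I N r c = (\<lambda>x. x +o D r c) ` I (nat (r - c))"
  by (simp add: entry_space_def quotient_space_def I_0)

lemma subspace_D: "subspace (D r c)"
  unfolding entry_den_eq by (rule subspace_I)

text \<open>The following two facts make the matrices with entries in \<open>D\<close> a two-sided ideal.\<close>

lemma mult_D_left: "x \<in> D r s \<Longrightarrow> y \<in> I (nat (s - c)) \<Longrightarrow> x * y \<in> D r c"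
  unfolding entry_den_eq by (erule (1) mult_I_nat) simp

lemma mult_D_right: "x \<in> I (nat (r - s)) \<Longrightarrow> y \<in> D s c \<Longrightarrow> x * y \<in> D r c"
  unfolding entry_den_eq by (erule (1) mult_I_nat) simp

definition matrices :: "('k, int \<Rightarrow> int \<Rightarrow> 'a) kalgebra" where
  "matrices =
     \<lparr>acarrier = {x. (\<forall>r c. x r c \<in> I (nat (r - c))) \<and> finitary x},
      aadd = (\<lambda>x y r c. x r c + y r c),
      azero = (\<lambda>r c. 0),
      ascale = (\<lambda>a x r c. scale a (x r c)),
      amult = matmul\<rparr>"

lemma matrices_simps [simp]:
  "x \<in> acarrier matrices \<longleftrightarrow> (\<forall>r c. x r c \<in> I (nat (r - c))) \<and> finitary x"
  "aadd matrices = (\<lambda>x y r c. x r c + y r c)"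
  "azero matrices = (\<lambda>r c. 0)"
  "ascale matrices = (\<lambda>a x r c. scale a (x r c))"
  "amult matrices = matmul"
  by (simp_all add: matrices_def)

lemma finitary_scale: "finitary x \<Longrightarrow> finitary (\<lambda>r c. scale a (x r c))"
  by (rule finitary_map) simp_all

lemma matmul_scale_left:
  assumes "finitary x"
  shows "matmul (\<lambda>r c. scale a (x r c)) y = (\<lambda>r c. scale a (matmul x y r c))"
proof (intro ext)
  fix r c
  obtain F where F: "supported_on F x" using assms unfolding finitary_def by blast
  then have "supported_on F (\<lambda>r c. scale a (x r c))" unfolding supported_on_def by auto
  then show "matmul (\<lambda>r c. scale a (x r c)) y r c = scale a (matmul x y r c)"
    by (simp add: matmul_eq_sum[OF F] matmul_eq_sum scale_mult_left scale_sum_right)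
qed

lemma matmul_scale_right: "matmul x (\<lambda>r c. scale a (y r c)) = (\<lambda>r c. scale a (matmul x y r c))"
  by (simp add: fun_eq_iff matmul_def scale_mult_right scale_sum_right)

lemma matmul_in_I:
  assumes "\<And>r c. x r c \<in> I (nat (r - c))" "\<And>r c. y r c \<in> I (nat (r - c))"
  shows "matmul x y r c \<in> I (nat (r - c))"
  unfolding matmul_def
  by (intro subspace_sum subspace_I mult_I_nat[OF assms]) simp

lemma matrices_k_algebra: "k_algebra matrices"
proof
  fix x assume x: "x \<in> acarrier matrices"
  have "scale (- 1) (x r c) \<in> I (nat (r - c))" for r c
    by (intro subspace_scale subspace_I) (use x in simp)
  moreover have "finitary (\<lambda>r c. scale (- 1) (x r c))" 
    by (rule finitary_scale) (use x in simp)
  ultimately show "\<exists>y\<in>acarrier matrices. aadd matrices x y = azero matrices"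
    by (intro bexI[of _ "\<lambda>r c. scale (- 1) (x r c)"]) auto
qed (simp_all add: subspace_add[OF subspace_I] subspace_scale[OF subspace_I]
    subspace_0[OF subspace_I] finitary_zero finitary_add finitary_matmul matmul_in_I finitary_scale
    matmul_assoc matmul_add_left matmul_add_right matmul_scale_left matmul_scale_right add_ac
    scale_left_distrib scale_right_distrib)

definition coset_matrix :: "(int \<Rightarrow> int \<Rightarrow> 'a) \<Rightarrow> int \<Rightarrow> int \<Rightarrow> 'a set" where
  "coset_matrix x r c = x r c +o D r c"

lemma D_add_D: "D r c + D r c = D r c"
  using subspace_D[of r c] by (force simp: set_plus_def subspace_def)

lemma coset_eq_iff: "x +o D r c = y +o D r c \<longleftrightarrow> x - y \<in> D r c"
proof
  assume eq: "x +o D r c = y +o D r c"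
  have "x \<in> x +o D r c"
    using subspace_0[OF subspace_D] by (force simp: elt_set_plus_def)
  then show "x - y \<in> D r c" unfolding eq by (auto simp: elt_set_plus_def)
next
  assume d: "x - y \<in> D r c"
  have "x + b = y + ((x - y) + b)" "y + b = x + (b - (x - y))" for b by simp_all
  moreover have "(x - y) + b \<in> D r c" "b - (x - y) \<in> D r c" if "b \<in> D r c" for b
    using that d subspace_add subspace_diff subspace_D by blast+
  ultimately show "x +o D r c = y +o D r c"
    unfolding elt_set_plus_def by blast
qed

lemma coset_eq_D_iff: "x +o D r c = D r c \<longleftrightarrow> x \<in> D r c"
  using coset_eq_iff[of x r c 0] by simp

lemma coset_matrix_eq_zero_iff: "coset_matrix x = D \<longleftrightarrow> (\<forall>r c. x r c \<in> D r c)"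
  by (auto simp: fun_eq_iff coset_matrix_def coset_eq_D_iff)

text \<open>The elementwise product of two cosets is in general only a part of a coset. Adding \<open>D r c\<close>
  completes any nonempty part of a coset, and doing so once, after summing, suffices because
  \<open>D r c + D r c = D r c\<close>.\<close>

lemma sum_in_cosets:
  assumes "finite S" "\<And>s. s \<in> S \<Longrightarrow> Z s \<noteq> {}" "\<And>s. s \<in> S \<Longrightarrow> Z s \<subseteq> z s +o D r c"
  shows "(\<Sum>s\<in>S. Z s) + D r c = (\<Sum>s\<in>S. z s) +o D r c"
  using assms
proof (induction S rule: finite_induct)
  case empty
  then show ?case by simp
next
  case (insert a S)
  have Z: "Z a + D r c = z a +o D r c"
  proof -
    obtain w where w: "w \<in> Z a" using insert.prems(1) by blast
    have eq: "v +o D r c = z a +o D r c" if "v \<in> Z a" for v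
      using insert.prems(2)[of a] that by (subst coset_eq_iff) (auto simp: elt_set_plus_def)
    have "Z a + D r c = (\<Union>v\<in>Z a. v +o D r c)"
      by (auto simp: set_plus_def elt_set_plus_def)
    also have "\<dots> = z a +o D r c" using eq w by blast
    finally show ?thesis .
  qed
  have "(\<Sum>s\<in>insert a S. Z s) + D r c = Z a + (\<Sum>s\<in>S. z s) +o D r c"
    using insert by (simp add: add.assoc)
  also have "\<dots> = (\<Sum>s\<in>S. z s) +o (Z a + D r c)"
    by (simp add: set_plus_rearranges)
  also have "\<dots> = (\<Sum>s\<in>insert a S. z s) +o D r c"
    using insert.hyps by (simp add: Z set_plus_rearranges add.commute)
  finally show ?case .
qed

text \<open>The sum on the right runs over the positions with nonzero classes, a subset of the positions
  with nonzero representatives. The additional terms of \<open>matmul\<close> have a factor in \<open>D\<close>, so they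
  vanish modulo \<open>D r c\<close>.\<close>

lemma coset_matrix_mult:
  assumes x: "x \<in> acarrier matrices" and y: "y \<in> acarrier matrices"
  shows "coset_matrix (matmul x y) r c =
    (\<Sum>s | coset_matrix x r s \<noteq> D r s \<and> coset_matrix y s c \<noteq> D s c.
       coset_matrix x r s * coset_matrix y s c) + D r c"
proof -
  let ?S = "{s. coset_matrix x r s \<noteq> D r s \<and> coset_matrix y s c \<noteq> D s c}"
  obtain F where F: "supported_on F x"
    using x unfolding matrices_simps finitary_def by blast
  have S: "s \<in> ?S \<longleftrightarrow> x r s \<notin> D r s \<and> y s c \<notin> D s c" for s
    by (simp add: coset_matrix_def coset_eq_D_iff)
  have sub: "?S \<subseteq> F"
  proof
    fix s assume "s \<in> ?S"
    then have "x r s \<notin> D r s" using S[of s] by blast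
    then have "x r s \<noteq> 0" using subspace_0[OF subspace_D] by auto
    then show "s \<in> F" using F unfolding supported_on_def by blast
  qed
  have fin: "finite F" using F by (rule supported_on_finite)
  have prod: "coset_matrix x r s * coset_matrix y s c \<subseteq> (x r s * y s c) +o D r c" for s
  proof
    fix w assume "w \<in> coset_matrix x r s * coset_matrix y s c"
    then obtain d e where d: "d \<in> D r s" and e: "e \<in> D s c"
      and w: "w = (x r s + d) * (y s c + e)"
      unfolding coset_matrix_def elt_set_plus_def set_times_def by auto
    have "D r s \<subseteq> I (nat (r - s))"
      unfolding entry_den_eq by (intro I_antimono nat_mono) simp
    then have "x r s + d \<in> I (nat (r - s))" using x d subspace_add[OF subspace_I] by auto
    then have "(x r s + d) * e \<in> D r c" using e by (rule mult_D_right)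
    moreover have "d * y s c \<in> D r c" using d y by (intro mult_D_left) auto
    ultimately have "d * y s c + (x r s + d) * e \<in> D r c"
      using subspace_add[OF subspace_D] by blast
    moreover have "w = x r s * y s c + (d * y s c + (x r s + d) * e)"
      unfolding w by (simp add: algebra_simps)
    ultimately show "w \<in> (x r s * y s c) +o D r c" unfolding elt_set_plus_def by blast
  qed
  have ne: "coset_matrix x r s * coset_matrix y s c \<noteq> {}" for s
    using subspace_0[OF subspace_D]
    by (force simp: coset_matrix_def elt_set_plus_def set_times_def)
  have "matmul x y r c = (\<Sum>s\<in>?S. x r s * y s c) + (\<Sum>s\<in>F - ?S. x r s * y s c)"
    unfolding matmul_eq_sum[OF F]
    by (subst sum.subset_diff[OF sub fin]) (rule add.commute)
  moreover have "(\<Sum>s\<in>F - ?S. x r s * y s c) \<in> D r c"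
  proof (rule subspace_sum[OF subspace_D])
    fix s assume "s \<in> F - ?S"
    then have "x r s \<in> D r s \<or> y s c \<in> D s c" using S by blast
    moreover have "x r s \<in> I (nat (r - s))" "y s c \<in> I (nat (s - c))" using x y by simp_all
    ultimately show "x r s * y s c \<in> D r c" using mult_D_left mult_D_right by blast
  qed
  ultimately have "coset_matrix (matmul x y) r c = (\<Sum>s\<in>?S. x r s * y s c) +o D r c"
    unfolding coset_matrix_def by (subst coset_eq_iff) simp
  also have "\<dots> = (\<Sum>s\<in>?S. coset_matrix x r s * coset_matrix y s c) + D r c"
    using prod ne finite_subset[OF sub fin] by (intro sum_in_cosets[symmetric]) auto
  finally show ?thesis .
qed

lemma scale_coset: "scale a ` (x +o D r c) + D r c = scale a x +o D r c"
proof -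
  have "scale a ` (x +o D r c) \<subseteq> scale a x +o D r c"
    using subspace_scale[OF subspace_D] by (auto simp: elt_set_plus_def scale_right_distrib)
  moreover have "scale a ` (x +o D r c) \<noteq> {}"
    using subspace_0[OF subspace_D] by (force simp: elt_set_plus_def)
  ultimately show ?thesis
    using sum_in_cosets[of "{()}" "\<lambda>_. scale a ` (x +o D r c)" "\<lambda>_. scale a x" r c] by simp
qed

lemma coset_matrix_surj:
  "coset_matrix ` acarrier matrices = acarrier (matrix_algebra scale I N)"
proof (intro equalityI subsetI)
  fix X assume "X \<in> coset_matrix ` acarrier matrices"
  then obtain x where x: "x \<in> acarrier matrices" and X: "X = coset_matrix x" by blast
  have "{(r, c). X r c \<noteq> D r c} \<subseteq> {(r, c). x r c \<noteq> 0}"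
    unfolding X by (auto simp: coset_matrix_def)
  then have "finite {(r, c). X r c \<noteq> D r c}"
    using x finite_subset by (auto simp: finitary_iff)
  then show "X \<in> acarrier (matrix_algebra scale I N)"
    using x unfolding X by (auto simp: matrix_algebra_def entry_space_eq coset_matrix_def)
next
  fix X assume "X \<in> acarrier (matrix_algebra scale I N)"
  then have "X r c \<in> entry_space I N r c" and fin: "finite {(r, c). X r c \<noteq> D r c}" for r c
    by (auto simp: matrix_algebra_def)
  then have "\<exists>x. x \<in> I (nat (r - c)) \<and> X r c = x +o D r c" for r c
    unfolding entry_space_eq by blast
  then obtain x where x: "x r c \<in> I (nat (r - c))" "X r c = x r c +o D r c" for r c
    by metis
  \<comment> \<open>Representing zero classes by \<open>0\<close> keeps the support finite.\<close>
  define x' where "x' r c = (if X r c = D r c then 0 else x r c)" for r c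
  have "{(r, c). x' r c \<noteq> 0} \<subseteq> {(r, c). X r c \<noteq> D r c}" unfolding x'_def by auto
  then have "finitary x'" unfolding finitary_iff using fin finite_subset by blast
  moreover have "x' r c \<in> I (nat (r - c))" for r c
    unfolding x'_def using x(1) subspace_0[OF subspace_I] by simp
  moreover have "coset_matrix x' = X"
    unfolding coset_matrix_def x'_def by (intro ext) (simp add: x(2)[symmetric])
  ultimately show "X \<in> coset_matrix ` acarrier matrices" by force
qed

lemma matrix_algebra_quotient:
  "algebra_hom matrices (matrix_algebra scale I N) coset_matrix"
  unfolding algebra_hom_def
proof (intro conjI ballI allI)
  fix x assume "x \<in> acarrier matrices"
  then show "coset_matrix x \<in> acarrier (matrix_algebra scale I N)"
    using coset_matrix_surj by blast
next
  fix x y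
  have "(x r c + y r c) +o D r c = (x r c +o D r c) + (y r c +o D r c)" for r c
    by (simp add: set_plus_rearrange D_add_D)
  then show "coset_matrix (aadd matrices x y) =
      aadd (matrix_algebra scale I N) (coset_matrix x) (coset_matrix y)"
    by (simp add: matrix_algebra_def coset_matrix_def fun_eq_iff)
next
  fix a x
  show "coset_matrix (ascale matrices a x) =
      ascale (matrix_algebra scale I N) a (coset_matrix x)"
    by (simp add: matrix_algebra_def coset_matrix_def fun_eq_iff scale_coset)
next
  fix x y assume "x \<in> acarrier matrices" "y \<in> acarrier matrices"
  then show "coset_matrix (amult matrices x y) =
      amult (matrix_algebra scale I N) (coset_matrix x) (coset_matrix y)"
    by (intro ext, subst matrices_simps, subst coset_matrix_mult) (auto simp: matrix_algebra_def)
qed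

end


section \<open>The matrix trace form\<close>

locale filtered_symmetric_algebra = filtered_algebra scale I N
  for scale :: "'k::field \<Rightarrow> 'a::ring_1 \<Rightarrow> 'a" and I N +
  fixes \<beta> :: "'a \<Rightarrow> 'a \<Rightarrow> 'k"
  assumes form: "symmetric_trace_form (type_algebra scale) \<beta>"
    and pairing: "j \<le> N \<Longrightarrow> induces_nondegenerate_pairing \<beta> (I j) (I (N - j))"
begin

lemma form_add: "\<beta> (x + y) z = \<beta> x z + \<beta> y z" "\<beta> x (y + z) = \<beta> x y + \<beta> x z"
  and form_scale: "\<beta> (scale a x) y = a * \<beta> x y" "\<beta> x (scale a y) = a * \<beta> x y"
  and form_sym: "\<beta> x y = \<beta> y x"
  and form_assoc: "\<beta> (x * y) z = \<beta> x (y * z)"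
  using form
  unfolding symmetric_trace_form_def bilinear_form_def type_algebra_def kalgebra.simps ball_UNIV
  by blast+

lemma form_zero [simp]: "\<beta> 0 x = 0" "\<beta> x 0 = 0"
  using form_scale(1)[of 0 0 x] form_scale(2)[of x 0 0] by simp_all

lemma form_sum: "\<beta> (\<Sum>s\<in>S. f s) x = (\<Sum>s\<in>S. \<beta> (f s) x)" "\<beta> x (\<Sum>s\<in>S. f s) = (\<Sum>s\<in>S. \<beta> x (f s))"
  by (induction S rule: infinite_finite_induct; simp add: form_add)+

lemma pairing_nondegenerate:
  assumes "j \<le> N"
  shows "(\<And>y. y \<in> I (N - j) \<Longrightarrow> \<beta> x y = 0) \<Longrightarrow> x \<in> I j"
    and "y \<in> I (N - j) \<Longrightarrow> (\<And>x. \<beta> x y = 0) \<Longrightarrow> y = 0"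
proof -
  obtain P where P: "\<And>a y. y \<in> I (N - j) \<Longrightarrow> P (a +o I j) y = \<beta> a y"
    and nd: "nondegenerate_pairing (quotient_space UNIV (I j)) (I j) (I (N - j)) 0 P"
    using pairing[OF assms] unfolding induces_nondegenerate_pairing_def by blast
  show "x \<in> I j" if "\<And>y. y \<in> I (N - j) \<Longrightarrow> \<beta> x y = 0"
  proof -
    have "\<forall>y\<in>I (N - j). P (x +o I j) y = 0" using that P by simp
    then have "x +o I j = I j"
      using nd unfolding nondegenerate_pairing_def quotient_space_def by blast
    moreover have "x \<in> x +o I j"
      using subspace_0[OF subspace_I] by (force simp: elt_set_plus_def)
    ultimately show ?thesis by simp
  qed
  show "y = 0" if "y \<in> I (N - j)" "\<And>x. \<beta> x y = 0"
  proof -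
    have "\<forall>X\<in>quotient_space UNIV (I j). P X y = 0"
      using that P unfolding quotient_space_def by auto
    then show ?thesis using nd that(1) unfolding nondegenerate_pairing_def by blast
  qed
qed

text \<open>Associativity moves the form to \<open>(x y, 1)\<close>, and here \<open>x y \<in> I N = {0}\<close> because the two
  filtration degrees add up to at least \<open>N\<close>.\<close>

lemma D_annihilates:
  assumes "x \<in> D r c" "y \<in> I (nat (c - r))"
  shows "\<beta> x y = 0"
proof -
  have "x * y \<in> I (nat (int N))"
    using assms unfolding entry_den_eq by (rule mult_I_nat) simp
  then have "x * y = 0" using I_ge_N by simp
  then show ?thesis using form_assoc[of x y 1] by simp
qed

text \<open>Below the diagonal, \<open>y\<close> ranges over all of \<open>A\<close>, and \<open>x\<close> is the argument from \<open>I j\<close>, with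
  \<open>j = r - c\<close>, of the pairing with \<open>A/I (N - j)\<close>. On and above it, \<open>y\<close> ranges over \<open>I j\<close>, with
  \<open>j = c - r\<close>, and \<open>x\<close> represents the argument from \<open>A/I (N - j)\<close>. At distance more than \<open>N\<close>
  from the diagonal the entry spaces are zero.\<close>

lemma annihilator_le_D:
  assumes x: "x \<in> I (nat (r - c))" and ann: "\<And>y. y \<in> I (nat (c - r)) \<Longrightarrow> \<beta> x y = 0"
  shows "x \<in> D r c"
proof -
  consider "r - c > int N" | "0 < r - c" "r - c \<le> int N"
    | "r - c \<le> 0" "c - r \<le> int N" | "c - r > int N"
    by linarith
  then show ?thesis
  proof cases
    case 1
    then have "I (nat (r - c)) = {0}" by (intro I_ge_N) linarith
    then show ?thesis using x subspace_0[OF subspace_D] by simp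
  next
    case 2
    then have "N - (N - nat (r - c)) = nat (r - c)" by linarith
    moreover have "\<beta> z x = 0" for z using ann[of z] 2 form_sym by (simp add: I_0)
    ultimately have "x = 0" using pairing_nondegenerate(2)[of "N - nat (r - c)" x] x by simp
    then show ?thesis using subspace_0[OF subspace_D] by simp
  next
    case 3
    then have "N - nat (int N + r - c) = nat (c - r)" by linarith
    then show ?thesis
      using pairing_nondegenerate(1)[of "nat (int N + r - c)" x] ann 3
      unfolding entry_den_eq by simp
  next
    case 4
    then show ?thesis unfolding entry_den_eq by (simp add: I_0)
  qed
qed

definition trace_form :: "(int \<Rightarrow> int \<Rightarrow> 'a) \<Rightarrow> (int \<Rightarrow> int \<Rightarrow> 'a) \<Rightarrow> 'k" where
  "trace_form x y = (\<Sum>(r, c) | x r c \<noteq> 0. \<beta> (x r c) (y c r))"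

lemma trace_form_eq_sum:
  assumes "supported_on F x"
  shows "trace_form x y = (\<Sum>r\<in>F. \<Sum>c\<in>F. \<beta> (x r c) (y c r))"
proof -
  have "trace_form x y = (\<Sum>(r, c)\<in>F \<times> F. \<beta> (x r c) (y c r))"
    unfolding trace_form_def
    by (rule sum.mono_neutral_left) (use assms in \<open>auto simp: supported_on_def\<close>)
  then show ?thesis by (simp add: sum.cartesian_product)
qed

lemma trace_form_sym:
  assumes "finitary x" "finitary y"
  shows "trace_form x y = trace_form y x"
proof -
  obtain F where F: "supported_on F x" "supported_on F y"
    using assms finitary_common_support[of x y y "{}"] by blast
  show ?thesis
    unfolding trace_form_eq_sum[OF F(1)] trace_form_eq_sum[OF F(2)]
    by (subst sum.swap) (simp add: form_sym)
qed

lemma trace_form_assoc: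
  assumes "finitary x" "finitary y" "finitary z"
  shows "trace_form (matmul x y) z = trace_form x (matmul y z)"
proof -
  obtain F where F: "supported_on F x" "supported_on F y" "supported_on F z"
    using assms finitary_common_support[of x y z "{}"] by blast
  have "trace_form (matmul x y) z = (\<Sum>r\<in>F. \<Sum>c\<in>F. \<Sum>s\<in>F. \<beta> (x r s) (y s c * z c r))"
    by (simp add: trace_form_eq_sum[OF supported_on_matmul[OF F(1,2)]] matmul_eq_sum[OF F(1)]
        form_sum form_assoc)
  also have "\<dots> = (\<Sum>r\<in>F. \<Sum>s\<in>F. \<Sum>c\<in>F. \<beta> (x r s) (y s c * z c r))"
    by (intro sum.cong refl sum.swap)
  also have "\<dots> = trace_form x (matmul y z)"
    by (simp add: trace_form_eq_sum[OF F(1)] matmul_eq_sum[OF F(2)] form_sum)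
  finally show ?thesis .
qed

lemma trace_form_add_right:
  "trace_form x (\<lambda>r c. y r c + z r c) = trace_form x y + trace_form x z"
  by (simp add: trace_form_def form_add sum.distrib case_prod_unfold)

lemma trace_form_scale_right: "trace_form x (\<lambda>r c. scale a (y r c)) = a * trace_form x y"
  by (simp add: trace_form_def form_scale sum_distrib_left case_prod_unfold)

lemma trace_form_bilinear: "bilinear_form matrices trace_form"
proof -
  have "trace_form (\<lambda>r c. x r c + y r c) z = trace_form x z + trace_form y z"
    if "finitary x" "finitary y" "finitary z" for x y z
    using that trace_form_sym trace_form_add_right by (simp add: finitary_add)
  moreover have "trace_form (\<lambda>r c. scale a (x r c)) y = a * trace_form x y"
    if "finitary x" "finitary y" for x y a
    using that trace_form_sym trace_form_scale_right by (simp add: finitary_scale)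
  ultimately show ?thesis
    by (simp add: bilinear_form_def trace_form_add_right trace_form_scale_right)
qed

lemma trace_form_single:
  assumes "finitary x"
  shows "trace_form x (\<lambda>i j. if i = c \<and> j = r then y else 0) = \<beta> (x r c) y"
proof -
  let ?y = "\<lambda>i j. if i = c \<and> j = r then y else 0"
  have "trace_form x ?y = trace_form ?y x"
    using assms finitary_single by (rule trace_form_sym)
  also have "\<dots> = (\<Sum>(i, j)\<in>{(c, r)}. \<beta> (?y i j) (x j i))"
    unfolding trace_form_def by (rule sum.mono_neutral_left) auto
  finally show ?thesis by (simp add: form_sym)
qed

text \<open>Testing against matrices with a single nonzero entry reduces the radical to annihilators of
  the individual entries.\<close>

lemma trace_form_radical:
  assumes x: "x \<in> acarrier matrices"
  shows "(\<forall>y\<in>acarrier matrices. trace_form x y = 0) \<longleftrightarrow> coset_matrix x = D"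
  unfolding coset_matrix_eq_zero_iff
proof (intro iffI allI ballI)
  fix r c assume rad: "\<forall>y\<in>acarrier matrices. trace_form x y = 0"
  show "x r c \<in> D r c"
  proof (rule annihilator_le_D)
    fix y assume y: "y \<in> I (nat (c - r))"
    have "(\<lambda>i j. if i = c \<and> j = r then y else 0) \<in> acarrier matrices"
      using y finitary_single[of c r y] subspace_0[OF subspace_I] by simp
    then show "\<beta> (x r c) y = 0" using rad x trace_form_single by fastforce
  qed (use x in simp)
next
  fix y assume "\<forall>r c. x r c \<in> D r c" "y \<in> acarrier matrices"
  then have "\<beta> (x r c) (y c r) = 0" for r c by (intro D_annihilates[of _ r c]) simp_all
  then show "trace_form x y = 0" by (simp add: trace_form_def)
qed

theorem symmetric_matrix_algebra: "symmetric_algebra (matrix_algebra scale I N)"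
proof (rule symmetric_algebra_of_radical[OF matrices_k_algebra matrix_algebra_quotient
      coset_matrix_surj _ trace_form_bilinear])
  show "coset_matrix (azero matrices) = azero (matrix_algebra scale I N)"
    by (simp add: matrix_algebra_def coset_matrix_def fun_eq_iff)
  show "(\<forall>y\<in>acarrier matrices. trace_form x y = 0) \<longleftrightarrow>
      coset_matrix x = azero (matrix_algebra scale I N)" if "x \<in> acarrier matrices" for x
    using trace_form_radical[OF that] by (simp add: matrix_algebra_def)
qed (simp_all add: trace_form_sym trace_form_assoc)

end

theorem theorem4:
  fixes scale :: "'k::alg_closed_field \<Rightarrow> 'a::ring_1 \<Rightarrow> 'a"
    and Q :: "('v, 'e) pre_digraph"
    and R :: "('v \<times> 'e list \<Rightarrow> 'k) set"
    and I :: "nat \<Rightarrow> 'a set"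
    and N :: nat
    and \<beta> :: "'a \<Rightarrow> 'a \<Rightarrow> 'k"
  assumes "finite_dim_algebra scale"
    and "basic_algebra TYPE('a)"
    and "fin_digraph Q"
    and "given_by_quiver (type_algebra scale) Q R"
    and "ideal_filtration scale I N"
    and "\<And>i. i < N \<Longrightarrow> semisimple_bimodule (quotient_bimodule (I i) (I (Suc i)))"
    and "symmetric_trace_form (type_algebra scale) \<beta>"
    and "\<And>j. j \<le> N \<Longrightarrow> induces_nondegenerate_pairing \<beta> (I j) (I (N - j))"
  shows "symmetric_algebra (matrix_algebra scale I N)"
proof -
  interpret A: finite_dim_algebra scale by (rule assms(1))
  interpret filtered_symmetric_algebra scale I N \<beta>
    using assms(5,7,8) A.scale_mult_left A.scale_mult_right by unfold_locales
  show ?thesis by (rule symmetric_matrix_algebra)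
qed

end
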